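(* Let the ground field have characteristic $0$. 1. Let $\mathfrak{g}$ be a finite dimensional perfect Lie algebra, i.e. $\mathfrak{g}=[\mathfrak{g},\mathfrak{g}]$. Then the product $\alpha_0(u,v)=\frac12[u,v]$ is the only strongly quasi-canonical product on $\mathfrak{g}$. 2. Let $\mathfrak{g}$ be a finite dimensional semi-simple Lie algebra. Then the product $\alpha_0(u,v)=\frac12[u,v]$ is the only quasi-canonical product on $\mathfrak{g}$. In particular, there is no non trivial Poisson structure on $\mathfrak{g}$.
   Context: Let $\mathfrak{g}$ be a finite dimensional Lie algebra and $\alpha$ a bilinear product on $\mathfrak{g}$, with $\mathrm{L}_uv=\alpha(u,v)$ and curvature $K^\alpha(u,v)=[\mathrm{L}_u,\mathrm{L}_v]-\mathrm{L}_{[u,v]}$. The product $\alpha$ is quasi-canonical if it is Lie-admissible ($\alpha(u,v)-\alpha(v,u)=[u,v]$), bi-invariant ($[u,\alpha(v,w)]=\alpha([u,v],w)+\alpha(v,[u,w])$), and $K^\alpha(u,v)=-\frac14\mathrm{ad}_{[u,v]}$, for all $u,v,w$. Its holonomy Lie algebra is then $\mathfrak{h}^\alpha=\mathrm{ad}_{[\mathfrak{g},\mathfrak{g}]}+\mathrm{L}_{[\mathfrak{g},[\mathfrak{g},\mathfrak{g}]]}\subset\mathrm{End}(\mathfrak{g})$, and $\alpha$ is strongly quasi-canonical if it is quasi-canonical and $\mathfrak{h}^\alpha=\mathrm{ad}_{[\mathfrak{g},\mathfrak{g}]}$. A Poisson structure on $\mathfrak{g}$ is a commutative and associative bilinear product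 $\circ$ on $\mathfrak{g}$ such that $[u,v\circ w]=[u,v]\circ w+v\circ[u,w]$ for all $u,v,w$; it is trivial if $u\circ v=0$ for all $u,v$. *)

theory Defs
  imports Complex_Main
begin

definition bilinear_product ::
  "('k::field \<Rightarrow> 'g::ab_group_add \<Rightarrow> 'g) \<Rightarrow> ('g \<Rightarrow> 'g \<Rightarrow> 'g) \<Rightarrow> bool" where
  "bilinear_product scale p \<longleftrightarrow>
     (\<forall>u. Vector_Spaces.linear scale scale (\<lambda>v. p u v)) \<and>
     (\<forall>v. Vector_Spaces.linear scale scale (\<lambda>u. p u v))"

definition trivial_product :: "('g \<Rightarrow> 'g \<Rightarrow> 'g::zero) \<Rightarrow> bool" where
  "trivial_product p \<longleftrightarrow> (\<forall>u v. p u v = 0)"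

definition commutator :: "('g \<Rightarrow> 'g::ab_group_add) \<Rightarrow> ('g \<Rightarrow> 'g) \<Rightarrow> 'g \<Rightarrow> 'g" where
  "commutator f g = (\<lambda>w. f (g w) - g (f w))"

text \<open>The Lie algebra is the whole type \<open>'g\<close>; neither finite dimension nor a restriction on the
  characteristic is built in.\<close>

locale lie_algebra = vector_space scale
  for scale :: "'k::field \<Rightarrow> 'g::ab_group_add \<Rightarrow> 'g" (infixr \<open>*s\<close> 75) +
  fixes bracket :: "'g \<Rightarrow> 'g \<Rightarrow> 'g"
  assumes bilinear_bracket: "bilinear_product scale bracket"
    and bracket_self: "bracket u u = 0"
    and jacobi: "bracket u (bracket v w) + bracket v (bracket w u) + bracket w (bracket u v) = 0"
begin

abbreviation ad :: "'g \<Rightarrow> 'g \<Rightarrow> 'g" where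
  "ad u \<equiv> bracket u"

definition bracket_space :: "'g set \<Rightarrow> 'g set \<Rightarrow> 'g set" where
  "bracket_space A B = span {bracket a b | a b. a \<in> A \<and> b \<in> B}"

definition perfect :: bool where
  "perfect \<longleftrightarrow> UNIV = bracket_space UNIV UNIV"

definition lie_ideal :: "'g set \<Rightarrow> bool" where
  "lie_ideal I \<longleftrightarrow> subspace I \<and> (\<forall>u. \<forall>v\<in>I. bracket u v \<in> I)"

fun derived_series :: "'g set \<Rightarrow> nat \<Rightarrow> 'g set" where
  "derived_series I 0 = I"
| "derived_series I (Suc n) = bracket_space (derived_series I n) (derived_series I n)"

definition solvable :: "'g set \<Rightarrow> bool" where
  "solvable I \<longleftrightarrow> (\<exists>n. derived_series I n = {0})"

text \<open>Vanishing of the radical; the zero algebra counts as semisimple.\<close>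

definition semisimple :: bool where
  "semisimple \<longleftrightarrow> (\<forall>I. lie_ideal I \<and> solvable I \<longrightarrow> I = {0})"

definition curvature :: "('g \<Rightarrow> 'g \<Rightarrow> 'g) \<Rightarrow> 'g \<Rightarrow> 'g \<Rightarrow> 'g \<Rightarrow> 'g" where
  "curvature \<alpha> u v = (\<lambda>w. commutator (\<alpha> u) (\<alpha> v) w - \<alpha> (bracket u v) w)"

definition lie_admissible :: "('g \<Rightarrow> 'g \<Rightarrow> 'g) \<Rightarrow> bool" where
  "lie_admissible \<alpha> \<longleftrightarrow> (\<forall>u v. \<alpha> u v - \<alpha> v u = bracket u v)"

definition bi_invariant :: "('g \<Rightarrow> 'g \<Rightarrow> 'g) \<Rightarrow> bool" where
  "bi_invariant \<alpha> \<longleftrightarrow>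
     (\<forall>u v w. bracket u (\<alpha> v w) = \<alpha> (bracket u v) w + \<alpha> v (bracket u w))"

text \<open>Only meaningful in characteristic different from 2, since \<open>1 / 4 = 0\<close> in characteristic 2.\<close>

definition quasi_canonical :: "('g \<Rightarrow> 'g \<Rightarrow> 'g) \<Rightarrow> bool" where
  "quasi_canonical \<alpha> \<longleftrightarrow>
     bilinear_product scale \<alpha> \<and> lie_admissible \<alpha> \<and> bi_invariant \<alpha> \<and>
     (\<forall>u v. curvature \<alpha> u v = (\<lambda>w. - ((1 / 4) *s ad (bracket u v) w)))"

text \<open>The left multiplication \<open>L\<^sub>u\<close> of \<open>\<alpha>\<close> is the partial application \<open>\<alpha> u\<close>, and subspaces of
  the endomorphism algebra are sets of functions.\<close>

definition holonomy :: "('g \<Rightarrow> 'g \<Rightarrow> 'g) \<Rightarrow> ('g \<Rightarrow> 'g) set" where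
  "holonomy \<alpha> =
     {\<lambda>w. f w + g w | f g. f \<in> ad ` bracket_space UNIV UNIV \<and>
        g \<in> \<alpha> ` bracket_space UNIV (bracket_space UNIV UNIV)}"

definition strongly_quasi_canonical :: "('g \<Rightarrow> 'g \<Rightarrow> 'g) \<Rightarrow> bool" where
  "strongly_quasi_canonical \<alpha> \<longleftrightarrow>
     quasi_canonical \<alpha> \<and> holonomy \<alpha> = ad ` bracket_space UNIV UNIV"

definition poisson_structure :: "('g \<Rightarrow> 'g \<Rightarrow> 'g) \<Rightarrow> bool" where
  "poisson_structure p \<longleftrightarrow>
     bilinear_product scale p \<and>
     (\<forall>u v. p u v = p v u) \<and>
     (\<forall>u v w. p (p u v) w = p u (p v w)) \<and>
     (\<forall>u v w. bracket u (p v w) = p (bracket u v) w + p v (bracket u w))"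

end

end

theory Submission
  imports Defs
begin

text \<open>Write \<open>\<alpha> u v = 1/2 [u, v] + u \<circ> v\<close>. Expanding the curvature shows that \<open>\<alpha>\<close> is
  quasi-canonical iff \<open>\<circ>\<close> is a Poisson structure.

  If \<open>\<alpha>\<close> is strongly quasi-canonical and the algebra is perfect, every multiplication \<open>u \<circ> _\<close> is an
  inner derivation. Combined with the invariance of \<open>\<circ>\<close> this makes each of the three products
  \<open>u \<circ> [v, w]\<close>, \<open>v \<circ> [w, u]\<close>, \<open>w \<circ> [u, v]\<close> the sum of the other two, so all of them vanish.

  In the semisimple case an idempotent of \<open>\<circ>\<close> is killed by all derivations, hence central, hence \<open>0\<close>.
  A finite dimensional commutative associative algebra \<open>A\<close> without nonzero idempotents is nilpotent.
  Since \<open>[A\<^sup>n, A\<^sup>n] \<subseteq> A\<^sup>n\<^sup>+\<^sup>1\<close> for \<open>n \<ge> 2\<close>, the ideal \<open>A\<^sup>2\<close> is solvable, hence \<open>0\<close>.\<close>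

section \<open>Linear algebra preliminaries: descending chains and bilinear products\<close>

lemma (in finite_dimensional_vector_space) decreasing_subspaces_stabilize:
  assumes sub: "\<And>n. subspace (F n)" and dec: "\<And>n. F (Suc n) \<subseteq> F n"
  shows "\<exists>n. \<forall>m\<ge>n. F m = F n"
proof -
  \<comment> \<open>A member of least dimension: later members lie inside it and cannot have smaller
    dimension.\<close>
  obtain n where n: "\<And>m. dim (F n) \<le> dim (F m)"
    using ex_has_least_nat[of "\<lambda>_. True" 0 "\<lambda>n. dim (F n)"] by auto
  have "F m = F n" if "m \<ge> n" for m
    using subspace_dim_equal[OF sub sub lift_Suc_antimono_le[of F, OF dec that] n] by simp
  then show ?thesis by blast
qed

lemma (in vector_space) bilinear_productD:
  assumes "bilinear_product scale p"
  shows "p (x + y) z = p x z + p y z" "p z (x + y) = p z x + p z y"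
    "p (scale c x) z = scale c (p x z)" "p z (scale c x) = scale c (p z x)"
    "p (x - y) z = p x z - p y z" "p z (x - y) = p z x - p z y"
    "p 0 z = 0" "p z 0 = 0" "p (- x) z = - p x z" "p z (- x) = - p z x"
proof -
  interpret l: Vector_Spaces.linear scale scale "\<lambda>v. p z v"
    using assms by (simp add: bilinear_product_def)
  interpret r: Vector_Spaces.linear scale scale "\<lambda>u. p u z"
    using assms by (simp add: bilinear_product_def)
  show "p (x + y) z = p x z + p y z" "p z (x + y) = p z x + p z y"
    "p (scale c x) z = scale c (p x z)" "p z (scale c x) = scale c (p z x)"
    "p (x - y) z = p x z - p y z" "p z (x - y) = p z x - p z y"
    "p 0 z = 0" "p z 0 = 0" "p (- x) z = - p x z" "p z (- x) = - p z x"
    by (rule l.add r.add l.scale r.scale l.diff r.diff l.zero r.zero l.neg r.neg)+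
qed

lemma (in vector_space) bilinear_productI:
  assumes "\<And>x y z. p (x + y) z = p x z + p y z" "\<And>x y z. p z (x + y) = p z x + p z y"
    "\<And>c x z. p (scale c x) z = scale c (p x z)" "\<And>c x z. p z (scale c x) = scale c (p z x)"
  shows "bilinear_product scale p"
  unfolding bilinear_product_def
  by (auto simp: assms Vector_Spaces.linear_def module_hom_def module_hom_axioms_def
      vector_space_axioms module_axioms)

section \<open>Commutative associative algebras without unit: idempotents and nilpotency\<close>

locale commutative_associative_product = vector_space scale
  for scale :: "'k::field \<Rightarrow> 'g::ab_group_add \<Rightarrow> 'g" (infixr \<open>*s\<close> 75) +
  fixes prod :: "'g \<Rightarrow> 'g \<Rightarrow> 'g" (infixl \<open>\<bullet>\<close> 70)
  assumes bilinear_prod: "bilinear_product scale (\<bullet>)"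
    and prod_commute: "x \<bullet> y = y \<bullet> x"
    and prod_assoc: "x \<bullet> y \<bullet> z = x \<bullet> (y \<bullet> z)"
begin

lemmas prod_bilinear = bilinear_productD[OF bilinear_prod]

lemma prod_left_commute: "x \<bullet> (y \<bullet> z) = y \<bullet> (x \<bullet> z)"
  by (metis prod_assoc prod_commute)

lemma iterate_prod: "((\<bullet>) x ^^ n) y \<bullet> z = ((\<bullet>) x ^^ n) (y \<bullet> z)"
  by (induction n) (simp_all add: prod_assoc)

lemma iterate_prod_add: "((\<bullet>) x ^^ n) (y + z) = ((\<bullet>) x ^^ n) y + ((\<bullet>) x ^^ n) z"
  by (induction n) (simp_all add: prod_bilinear)

lemma iterate_prod_scale: "((\<bullet>) x ^^ n) (c *s y) = c *s ((\<bullet>) x ^^ n) y"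
  by (induction n) (simp_all add: prod_bilinear)

lemma subspace_range_iterate_prod: "subspace (range ((\<bullet>) x ^^ n))"
proof (rule subspaceI)
  show "0 \<in> range ((\<bullet>) x ^^ n)"
    using iterate_prod_scale[of n x 0 0] by (metis rangeI scale_zero_left)
qed (auto simp flip: iterate_prod_add iterate_prod_scale)

text \<open>A Fitting argument. On the stable range \<open>J\<close> of the iterates of
  \<open>x\<close>, multiplication by a high power \<open>z\<close> of \<open>x\<close> is onto, and
  \<open>z\<close> itself lies in \<open>J\<close>. So \<open>z\<close> has a relative unit
  \<open>e\<close> in \<open>J\<close>, and \<open>e\<close> is again a multiple of
  \<open>z\<close>, which forces it to be idempotent.\<close>

lemma iterate_prod_zero_or_idempotent:
  assumes "finite_dimensional_vector_space scale Basis"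
  shows "(\<exists>n. ((\<bullet>) x ^^ n) x = 0) \<or> (\<exists>e. e \<noteq> 0 \<and> e \<bullet> e = e)"
proof -
  interpret finite_dimensional_vector_space scale Basis by fact
  let ?F = "\<lambda>n. range ((\<bullet>) x ^^ n)"
  have "?F (Suc n) \<subseteq> ?F n" for n
    by (auto simp: funpow_Suc_right simp del: funpow.simps)
  then obtain n where n: "\<And>m. m \<ge> n \<Longrightarrow> ?F m = ?F n"
    using decreasing_subspaces_stabilize[of ?F] subspace_range_iterate_prod by blast
  define z where "z = ((\<bullet>) x ^^ n) x"
  have div: "\<exists>f\<in>?F n. j = z \<bullet> f" if "j \<in> ?F n" for j
  proof -
    \<comment> \<open>Of the \<open>2n + 1\<close> factors \<open>x\<close>, \<open>n + 1\<close>
      make up \<open>z\<close>; the other \<open>n\<close> keep the cofactor in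
      \<open>?F n\<close>.\<close>
    have "j \<in> ?F (Suc n + n)" using that n[of "Suc n + n"] by simp
    then obtain y where "j = ((\<bullet>) x ^^ Suc n) (((\<bullet>) x ^^ n) y)"
      by (auto simp: funpow_add)
    also have "\<dots> = z \<bullet> ((\<bullet>) x ^^ n) y"
      unfolding z_def iterate_prod by (simp add: funpow_swap1)
    finally show ?thesis by blast
  qed
  have "z \<in> ?F n" by (simp add: z_def)
  then obtain e where e: "e \<in> ?F n" "z = z \<bullet> e" using div by blast
  obtain f where f: "e = z \<bullet> f" using div[OF e(1)] by blast
  have "e \<bullet> (z \<bullet> f) = z \<bullet> e \<bullet> f"
    by (simp only: prod_assoc prod_left_commute[of e])
  then have "e \<bullet> e = e"
    unfolding e(2)[symmetric] f[symmetric] .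
  moreover have "z = 0" if "e = 0"
    using e(2) unfolding that prod_bilinear .
  ultimately show ?thesis unfolding z_def by blast
qed

text \<open>A Nakayama argument: iterating \<open>I = x \<bullet> I + S \<bullet> I\<close> gives \<open>I = x\<^sup>n \<bullet> I + S \<bullet> I\<close>, so that a
  nilpotent generator \<open>x\<close> can be dropped.\<close>

lemma nilpotent_generators_imp_zero:
  assumes "finite S" and "\<And>s. s \<in> S \<Longrightarrow> \<exists>n. ((\<bullet>) s ^^ n) s = 0"
    and "subspace I" and stable: "\<And>x y. y \<in> I \<Longrightarrow> x \<bullet> y \<in> I"
    and "I \<subseteq> span {s \<bullet> y | s y. s \<in> S \<and> y \<in> I}"
  shows "I \<subseteq> {0}"
  using assms(1,2,5)
proof (induction S)
  case empty
  then show ?case by simp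
next
  case (insert x S)
  define W where "W = span {s \<bullet> y | s y. s \<in> S \<and> y \<in> I}"
  have W: "subspace W" by (simp add: W_def)
  \<comment> \<open>\<open>W\<close> must absorb products, since each iteration multiplies the
    earlier remainder by a power of \<open>x\<close>.\<close>
  have W_stable: "z \<bullet> w \<in> W" if "w \<in> W" for z w
    using that unfolding W_def
  proof (induction w rule: span_induct_alt)
    case base
    then show ?case by (simp add: prod_bilinear span_zero)
  next
    case (step c a b)
    then obtain s y where "a = s \<bullet> y" "s \<in> S" "y \<in> I" by blast
    then have "z \<bullet> a = s \<bullet> (z \<bullet> y)" "s \<in> S" "z \<bullet> y \<in> I"
      by (simp_all add: prod_left_commute stable)
    then have "z \<bullet> a \<in> span {s \<bullet> y | s y. s \<in> S \<and> y \<in> I}"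
      by (auto intro!: span_base)
    with step show ?case by (simp add: prod_bilinear span_add span_scale)
  qed
  have W_iterate: "((\<bullet>) z ^^ n) w \<in> W" if "w \<in> W" for z w n
    by (induction n) (use that W_stable in simp_all)
  have decomp: "\<exists>j\<in>I. \<exists>w\<in>W. i = x \<bullet> j + w" if "i \<in> I" for i
  proof -
    have "i \<in> span {s \<bullet> y | s y. s \<in> insert x S \<and> y \<in> I}" using insert.prems(2) that by blast
    then show ?thesis
    proof (induction i rule: span_induct_alt)
      case base
      have "0 = x \<bullet> 0 + 0" by (simp add: prod_bilinear)
      then show ?case using subspace_0[OF \<open>subspace I\<close>] subspace_0[OF W] by blast
    next
      case (step c a b)
      obtain j w where b: "j \<in> I" "w \<in> W" "b = x \<bullet> j + w" using step by blast
      obtain s y where a: "a = s \<bullet> y" "s \<in> insert x S" "y \<in> I" using step by blast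
      show ?case
      proof (cases "s = x")
        case True
        then have "c *s a + b = x \<bullet> (c *s y + j) + w"
          using a b by (simp add: prod_bilinear algebra_simps)
        then show ?thesis
          using a b \<open>subspace I\<close> by (meson subspace_add subspace_scale)
      next
        case False
        then have "a \<in> W" using a unfolding W_def by (auto intro!: span_base)
        then have "c *s a + w \<in> W" using W b by (simp add: subspace_add subspace_scale)
        moreover have "c *s a + b = x \<bullet> j + (c *s a + w)" using b by (simp add: algebra_simps)
        ultimately show ?thesis using b by blast
      qed
    qed
  qed
  have iter: "\<exists>j\<in>I. \<exists>w\<in>W. i = ((\<bullet>) x ^^ n) j + w" if "i \<in> I" for i n
  proof (induction n)
    case 0
    have "i = ((\<bullet>) x ^^ 0) i + 0" by simp
    then show ?case using that subspace_0[OF W] by blast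
  next
    case (Suc n)
    then obtain j w where jw: "j \<in> I" "w \<in> W" "i = ((\<bullet>) x ^^ n) j + w" by blast
    obtain j' w' where "j' \<in> I" "w' \<in> W" "j = x \<bullet> j' + w'" using decomp[OF jw(1)] by blast
    then have "i = ((\<bullet>) x ^^ Suc n) j' + (((\<bullet>) x ^^ n) w' + w)"
      "((\<bullet>) x ^^ n) w' + w \<in> W"
      using jw W W_iterate by (simp_all add: iterate_prod_add funpow_swap1 add.assoc subspace_add)
    then show ?case using \<open>j' \<in> I\<close> by blast
  qed
  obtain n where n: "((\<bullet>) x ^^ n) x = 0" using insert.prems(1) by blast
  \<comment> \<open>The hypothesis says that the power \<open>n + 1\<close> of \<open>x\<close>
    vanishes, hence \<open>Suc n\<close> iterations.\<close>
  have "((\<bullet>) x ^^ Suc n) j = 0" for j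
    using iterate_prod[of n x x j] n by (simp add: funpow_swap1 prod_bilinear)
  then have "I \<subseteq> W" using iter[of _ "Suc n"] by fastforce
  then show ?case using insert.IH insert.prems(1) unfolding W_def by blast
qed

text \<open>The index is shifted by one: \<open>power_space n\<close> is the power
  \<open>n + 1\<close> of the algebra, so the square is \<open>power_space 1\<close>.\<close>

fun power_space :: "nat \<Rightarrow> 'g set" where
  "power_space 0 = UNIV"
| "power_space (Suc n) = span {u \<bullet> v | u v. v \<in> power_space n}"

lemma subspace_power_space: "subspace (power_space n)"
  by (cases n) simp_all

lemma prod_in_power_space: "v \<in> power_space n \<Longrightarrow> u \<bullet> v \<in> power_space (Suc n)"
  by (auto intro!: span_base)

lemma power_space_Suc_subset: "power_space (Suc n) \<subseteq> power_space n"
proof (induction n)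
  case (Suc n)
  then have "{u \<bullet> v | u v. v \<in> power_space (Suc n)} \<subseteq> {u \<bullet> v | u v. v \<in> power_space n}"
    by blast
  then show ?case
    unfolding power_space.simps(2)[of "Suc n"] power_space.simps(2)[of n] by (rule span_mono)
qed simp

text \<open>The powers stabilize at an ideal reproduced by multiplication with the finitely many
  basis vectors. Without nonzero idempotents each of these is nilpotent, so the Nakayama argument
  kills the ideal.\<close>

lemma power_space_zero:
  assumes fin: "finite_dimensional_vector_space scale Basis"
    and no_idem: "\<And>e. e \<bullet> e = e \<Longrightarrow> e = 0"
  shows "\<exists>n. power_space n \<subseteq> {0}"
proof -
  interpret finite_dimensional_vector_space scale Basis by fact
  obtain n where stab: "\<And>m. m \<ge> n \<Longrightarrow> power_space m = power_space n"
    using decreasing_subspaces_stabilize[of power_space]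
      subspace_power_space power_space_Suc_subset by blast
  have n: "power_space (Suc n) = power_space n" by (rule stab) simp
  let ?I = "power_space n"
  let ?G = "span {s \<bullet> y | s y. s \<in> Basis \<and> y \<in> ?I}"
  have gen: "x \<bullet> y \<in> ?G" if "y \<in> ?I" for x y
  proof -
    have "x \<in> span Basis" by (simp add: span_Basis)
    then show ?thesis
    proof (induction x rule: span_induct_alt)
      case base
      then show ?case by (simp add: prod_bilinear span_zero)
    next
      case (step c a b)
      then have "a \<bullet> y \<in> ?G" using that by (auto intro!: span_base)
      then show ?case using step by (simp add: prod_bilinear span_add span_scale)
    qed
  qed
  have "power_space (Suc n) \<subseteq> ?G"
    unfolding power_space.simps by (rule span_minimal) (use gen in auto)
  then have "?I \<subseteq> ?G" unfolding n .
  moreover have "x \<bullet> y \<in> ?I" if "y \<in> ?I" for x y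
    using prod_in_power_space[OF that] n by blast
  ultimately have "?I \<subseteq> {0}"
    using nilpotent_generators_imp_zero[OF finite_Basis _ subspace_power_space]
      iterate_prod_zero_or_idempotent[OF fin] no_idem by blast
  then show ?thesis by blast
qed

end

section \<open>Quasi-canonical products versus Poisson structures; the perfect case\<close>

context lie_algebra
begin

lemmas bracket_bilinear = bilinear_productD[OF bilinear_bracket]

lemma bracket_commute: "bracket u v = - bracket v u"
proof -
  have "bracket (u + v) (u + v) = 0" by (rule bracket_self)
  then have "bracket u v + bracket v u = 0"
    unfolding bracket_bilinear by (simp add: bracket_self add.commute)
  then show ?thesis by (simp add: add_eq_0_iff2)
qed

lemma bracket_jacobi:
  "bracket u (bracket v w) = bracket (bracket u v) w + bracket v (bracket u w)"
proof -
  have "bracket w (bracket u v) = - bracket (bracket u v) w"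
    "bracket v (bracket w u) = - bracket v (bracket u w)"
    using bracket_commute[of w u] bracket_commute[of w "bracket u v"]
    by (simp_all add: bracket_bilinear)
  with jacobi[of u v w] show ?thesis by (simp add: algebra_simps)
qed

lemma bracket_space_0: "0 \<in> bracket_space A B"
  by (simp add: bracket_space_def span_zero)

text \<open>In the curvature identity the pure bracket terms match by Jacobi
  (\<open>1/4 - 1/2 = -1/4\<close>) and the mixed terms cancel by invariance. What remains is that
  the multiplications of \<open>p\<close> commute, which for a commutative product is
  associativity.\<close>

lemma poisson_of_quasi_canonical:
  assumes two: "(2::'k) \<noteq> 0" and qc: "quasi_canonical \<alpha>"
  shows "poisson_structure (\<lambda>u v. \<alpha> u v - (1 / 2) *s bracket u v)"
proof -
  define h :: 'k where "h = 1 / 2"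
  define p where "p = (\<lambda>u v. \<alpha> u v - h *s bracket u v)"
  have hh: "h + h = 1" "(1 / 4 :: 'k) = h * h"
    using two by (simp_all add: h_def field_simps flip: mult_2)
  have double: "h *s x + h *s x = x" for x
    using hh(1) by (simp flip: scale_left_distrib)
  have bil: "bilinear_product scale \<alpha>"
    and adm: "\<alpha> u v - \<alpha> v u = bracket u v"
    and inv: "bracket u (\<alpha> v w) = \<alpha> (bracket u v) w + \<alpha> v (bracket u w)"
    and curv: "\<alpha> u (\<alpha> v w) - \<alpha> v (\<alpha> u w) - \<alpha> (bracket u v) w
      = - (h *s h *s bracket (bracket u v) w)" for u v w
    using qc hh(2)
    by (auto simp: quasi_canonical_def lie_admissible_def bi_invariant_def curvature_def
        commutator_def fun_eq_iff)
  note simps = bilinear_productD[OF bil] bracket_bilinear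
  have bil_p: "bilinear_product scale p"
    by (rule bilinear_productI)
      (simp_all add: p_def simps scale_right_distrib scale_right_diff_distrib mult.commute)
  have comm_p: "p u v = p v u" for u v
    using adm[of u v] double[of "bracket u v"] bracket_commute[of v u]
    by (simp add: p_def algebra_simps)
  have inv_p: "bracket u (p v w) = p (bracket u v) w + p v (bracket u w)" for u v w
    using inv[of u v w] bracket_jacobi[of u v w]
    by (simp add: p_def simps algebra_simps)
  have \<alpha>: "\<alpha> u v = h *s bracket u v + p u v" for u v by (simp add: p_def)
  note psimps = bilinear_productD[OF bil_p] bracket_bilinear
  have "p u (p v w) = p v (p u w)" for u v w
  proof -
    let ?b = "bracket (bracket u v) w"
    have "h *s h *s ?b + h *s h *s ?b = h *s ?b"
      by (rule double)
    moreover have "h *s h *s bracket u (bracket v w) =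
        h *s h *s ?b + h *s h *s bracket v (bracket u w)"
      unfolding bracket_jacobi[of u v w] by (simp only: scale_right_distrib)
    moreover have "h *s bracket u (p v w) = h *s p (bracket u v) w + h *s p v (bracket u w)"
      unfolding inv_p by (simp only: scale_right_distrib)
    moreover have "h *s bracket v (p u w) = - (h *s p (bracket u v) w) + h *s p u (bracket v w)"
      unfolding inv_p bracket_commute[of v u] by (simp add: psimps scale_right_diff_distrib)
    moreover have "h *s p (bracket u v) w + h *s p (bracket u v) w = p (bracket u v) w"
      by (rule double)
    ultimately have "p u (p v w) + (h *s p u (bracket v w) + h *s p (bracket u v) w) =
        p v (p u w) + (p (bracket u v) w + h *s bracket v (p u w))"
      "h *s bracket v (p u w) + h *s p (bracket u v) w = h *s p u (bracket v w)"
      "h *s p (bracket u v) w + h *s p (bracket u v) w = p (bracket u v) w"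
      using curv[of u v w] unfolding \<alpha> psimps scale_right_distrib
      by (simp_all add: algebra_simps del: scale_scale)
    \<comment> \<open>Pure cancellation for arbitrary elements: \<open>X\<close> and
      \<open>Y\<close> stand for the two iterated products, \<open>Q\<close> for half of
      \<open>B = p (bracket u v) w\<close>.\<close>
    moreover have "X = Y" if "X + (A + Q) = Y + (B + C)" "C + Q = A" "Q + Q = B"
      for X Y A B C Q :: 'g
      using that(1) unfolding that(2,3)[symmetric] by (simp add: algebra_simps)
    ultimately show ?thesis by blast
  qed
  then have "p (p u v) w = p u (p v w)" for u v w
    by (metis comm_p)
  with bil_p comm_p inv_p have "poisson_structure p"
    unfolding poisson_structure_def by blast
  then show ?thesis by (simp add: p_def h_def)
qed

lemma holonomyI:
  assumes "f \<in> ad ` bracket_space UNIV UNIV"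
    and "g \<in> \<alpha> ` bracket_space UNIV (bracket_space UNIV UNIV)"
  shows "(\<lambda>w. f w + g w) \<in> holonomy \<alpha>"
  using assms unfolding holonomy_def by blast

text \<open>This gives existence for both uniqueness claims. The holonomy collapses because left
  multiplication by \<open>y\<close> is \<open>ad\<close> of half of \<open>y\<close>, and the
  derived algebra is a subspace containing the double brackets.\<close>

lemma half_bracket_strongly_quasi_canonical:
  assumes two: "(2::'k) \<noteq> 0"
  shows "strongly_quasi_canonical (\<lambda>u v. (1 / 2) *s bracket u v)"
proof -
  define h :: 'k where "h = 1 / 2"
  have hh: "h + h = 1" "(1 / 4 :: 'k) = h * h"
    using two by (simp_all add: h_def field_simps flip: mult_2)
  have double: "h *s x + h *s x = x" for x
    using hh(1) by (simp flip: scale_left_distrib)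
  let ?\<alpha> = "\<lambda>u v. h *s bracket u v"
  have "bilinear_product scale ?\<alpha>"
    by (rule bilinear_productI)
      (simp_all add: bracket_bilinear scale_right_distrib mult.commute)
  moreover have "lie_admissible ?\<alpha>"
    unfolding lie_admissible_def
    by (metis bracket_commute diff_minus_eq_add double scale_minus_right)
  moreover have "bi_invariant ?\<alpha>"
    unfolding bi_invariant_def
    by (metis bracket_bilinear(3,4) bracket_jacobi scale_right_distrib)
  moreover have "curvature ?\<alpha> u v w = - ((1 / 4) *s bracket (bracket u v) w)" for u v w
  proof -
    let ?b = "bracket (bracket u v) w"
    have "h *s h *s ?b + h *s h *s ?b = h *s ?b"
      by (rule double)
    moreover have "h *s h *s bracket u (bracket v w) =
        h *s h *s ?b + h *s h *s bracket v (bracket u w)"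
      unfolding bracket_jacobi[of u v w] by (simp only: scale_right_distrib)
    moreover have "(1 / 4) *s ?b = h *s h *s ?b"
      by (simp add: hh)
    ultimately show ?thesis
      unfolding curvature_def commutator_def bracket_bilinear
      by (simp add: algebra_simps del: scale_scale)
  qed
  ultimately have "quasi_canonical ?\<alpha>"
    unfolding quasi_canonical_def by blast
  moreover have "holonomy ?\<alpha> = ad ` bracket_space UNIV UNIV"
  proof
    show "ad ` bracket_space UNIV UNIV \<subseteq> holonomy ?\<alpha>"
    proof (rule image_subsetI)
      fix x assume x: "x \<in> bracket_space UNIV UNIV"
      have "(\<lambda>w. ad x w + ?\<alpha> 0 w) \<in> holonomy ?\<alpha>"
        by (intro holonomyI imageI x bracket_space_0)
      then show "ad x \<in> holonomy ?\<alpha>" by (simp add: bracket_bilinear)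
    qed
    show "holonomy ?\<alpha> \<subseteq> ad ` bracket_space UNIV UNIV"
    proof
      fix k assume "k \<in> holonomy ?\<alpha>"
      then obtain x y where xy: "x \<in> bracket_space UNIV UNIV"
        "y \<in> bracket_space UNIV (bracket_space UNIV UNIV)"
        and k: "k = (\<lambda>w. ad x w + ?\<alpha> y w)"
        unfolding holonomy_def by blast
      have "y \<in> bracket_space UNIV UNIV"
        using xy(2) unfolding bracket_space_def by (rule span_mono[THEN subsetD, rotated]) blast
      then have "x + h *s y \<in> bracket_space UNIV UNIV"
        using xy(1) unfolding bracket_space_def by (simp add: span_add span_scale)
      moreover have "k = ad (x + h *s y)"
        unfolding k by (simp add: bracket_bilinear fun_eq_iff)
      ultimately show "k \<in> ad ` bracket_space UNIV UNIV" by blast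
    qed
  qed
  ultimately show ?thesis unfolding strongly_quasi_canonical_def h_def by blast
qed

lemma perfect_strongly_quasi_canonical_unique:
  assumes two: "(2::'k) \<noteq> 0" and perfect and sqc: "strongly_quasi_canonical \<alpha>"
  shows "\<alpha> = (\<lambda>u v. (1 / 2) *s bracket u v)"
proof -
  define p where "p = (\<lambda>u v. \<alpha> u v - (1 / 2) *s bracket u v)"
  have UNIV: "bracket_space UNIV UNIV = UNIV"
    using \<open>perfect\<close> by (simp add: perfect_def)
  have "poisson_structure p"
    using poisson_of_quasi_canonical[OF two] sqc
    by (simp add: strongly_quasi_canonical_def p_def)
  then have bil: "bilinear_product scale p" and comm: "p u v = p v u"
    and inv: "bracket u (p v w) = p (bracket u v) w + p v (bracket u w)" for u v w
    unfolding poisson_structure_def by blast+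
  note psimps = bilinear_productD[OF bil]
  \<comment> \<open>By perfectness the double brackets also span everything, so each
    \<open>\<alpha> u\<close> lies in the holonomy and is some \<open>ad x\<close>. Subtracting half
    of \<open>ad u\<close> leaves an inner derivation.\<close>
  have der: "p u (bracket v w) = bracket (p u v) w + bracket v (p u w)" for u v w
  proof -
    have "(\<lambda>w. ad 0 w + \<alpha> u w) \<in> holonomy \<alpha>"
      by (intro holonomyI imageI) (simp_all add: UNIV)
    then have "\<alpha> u \<in> holonomy \<alpha>" by (simp add: bracket_bilinear)
    then obtain x where "\<alpha> u = ad x"
      using sqc unfolding strongly_quasi_canonical_def by blast
    then have "p u = ad (x - (1 / 2) *s u)"
      by (simp add: p_def bracket_bilinear fun_eq_iff)
    then show ?thesis by (simp only: bracket_jacobi[of _ v w])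
  qed
  \<comment> \<open>Invariance expands both terms on the right of \<open>der\<close>; each
    contributes one copy of the left side minus another cyclic product.\<close>
  have cyclic: "p u (bracket v w) = p v (bracket w u) + p w (bracket u v)" for u v w
  proof -
    have "bracket (p u v) w = p u (bracket v w) - p v (bracket w u)"
      unfolding bracket_commute[of "p u v"] inv comm[of "bracket w u"] bracket_commute[of w v]
      by (simp add: psimps)
    moreover have "bracket v (p u w) = p u (bracket v w) - p w (bracket u v)"
      unfolding inv bracket_commute[of v u]
      by (simp add: psimps comm[of w])
    moreover have "a = t + r" if "a = b + c" "b = a - t" "c = a - r" for a b c t r :: 'g
      using that(1) unfolding that(2,3) by (simp add: algebra_simps)
    ultimately show ?thesis using der by blast
  qed
  have zero: "p u (bracket v w) = 0" for u v w
  proof -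
    \<comment> \<open>Here \<open>a\<close>, \<open>b\<close>, \<open>c\<close> are the three cyclic
      products; two rotations of \<open>cyclic\<close> suffice.\<close>
    have "a + a = 0" if "b = c + a" "c = a + b" for a b c :: 'g
      using that(1) unfolding that(2) by (simp add: algebra_simps)
    then have "p u (bracket v w) + p u (bracket v w) = 0"
      using cyclic by blast
    then have "2 *s p u (bracket v w) = 0"
      by (metis one_add_one scale_left_distrib scale_one)
    then show ?thesis using two by simp
  qed
  have "p u x = 0" if "x \<in> bracket_space UNIV UNIV" for u x
    using that unfolding bracket_space_def
    by (induction x rule: span_induct_alt) (auto simp: psimps zero)
  then have "p u x = 0" for u x using UNIV by blast
  then show ?thesis by (simp add: p_def fun_eq_iff)
qed

end

section \<open>Poisson algebras and the semisimple case\<close>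

locale poisson_algebra = lie_algebra scale bracket + commutative_associative_product scale prod
  for scale :: "'k::field \<Rightarrow> 'g::ab_group_add \<Rightarrow> 'g" (infixr \<open>*s\<close> 75)
    and bracket and prod (infixl \<open>\<bullet>\<close> 70) +
  assumes bracket_prod: "bracket u (v \<bullet> w) = bracket u v \<bullet> w + v \<bullet> bracket u w"
begin

text \<open>A derivation \<open>d\<close> satisfies \<open>d e = 2 e (d e)\<close>. Multiplying by
  \<open>e\<close> gives \<open>e (d e) = 2 e (d e)\<close>, so \<open>e (d e)\<close> vanishes, and
  with it \<open>d e\<close>.\<close>

lemma bracket_idempotent:
  assumes "e \<bullet> e = e"
  shows "bracket u e = 0"
proof -
  let ?d = "bracket u e"
  have d: "?d = e \<bullet> ?d + e \<bullet> ?d"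
    using bracket_prod[of u e e] unfolding prod_commute[of ?d] assms .
  have "e \<bullet> ?d = e \<bullet> (e \<bullet> ?d) + e \<bullet> (e \<bullet> ?d)"
    by (subst d) (rule prod_bilinear)
  also have "e \<bullet> (e \<bullet> ?d) = e \<bullet> ?d"
    by (metis assms prod_assoc)
  finally have "e \<bullet> ?d = 0" by simp
  then show ?thesis by (subst d) simp
qed

lemma bracket_power_space: "v \<in> power_space n \<Longrightarrow> bracket u v \<in> power_space n"
proof (induction n arbitrary: v)
  case (Suc n)
  from Suc.prems have "v \<in> span {a \<bullet> b | a b. b \<in> power_space n}" by simp
  then show ?case
  proof (induction v rule: span_induct_alt)
    case base
    show ?case unfolding bracket_bilinear by (rule subspace_0[OF subspace_power_space])
  next
    case (step c a b)
    obtain x y where a: "a = x \<bullet> y" "y \<in> power_space n" using step by blast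
    have "bracket u a \<in> power_space (Suc n)"
      unfolding a(1) bracket_prod
      by (intro subspace_add subspace_power_space prod_in_power_space a(2) Suc.IH)
    with step show ?case
      using subspace_power_space
      by (simp add: bracket_bilinear subspace_add subspace_scale del: power_space.simps)
  qed
qed simp

text \<open>Leibniz on a product \<open>a \<bullet> b\<close> leaves a bracket with
  \<open>v\<close>, which stays in the power of \<open>v\<close>, times one extra factor: the degree
  rises by one.\<close>

lemma bracket_power_space_Suc:
  assumes v: "v \<in> power_space (Suc n)" and w: "w \<in> power_space 1"
  shows "bracket v w \<in> power_space (Suc (Suc n))"
proof -
  have "w \<in> span {a \<bullet> b | a b. b \<in> power_space 0}" using w by simp
  then show ?thesis
  proof (induction w rule: span_induct_alt)
    case base
    show ?case unfolding bracket_bilinear by (rule subspace_0[OF subspace_power_space])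
  next
    case (step c x y)
    obtain a b where x: "x = a \<bullet> b" using step by blast
    have "bracket v u \<in> power_space (Suc n)" for u
      unfolding bracket_commute[of v]
      by (intro subspace_neg subspace_power_space bracket_power_space v)
    then have "bracket v x \<in> power_space (Suc (Suc n))"
      unfolding x bracket_prod prod_commute[of "bracket v a"]
      by (intro subspace_add subspace_power_space prod_in_power_space)
    with step show ?case
      using subspace_power_space
      by (simp add: bracket_bilinear subspace_add subspace_scale del: power_space.simps)
  qed
qed

lemma derived_series_subset_power_space:
  "derived_series (power_space 1) n \<subseteq> power_space (Suc n)"
proof (induction n)
  case (Suc n)
  have "power_space (Suc n) \<subseteq> power_space 1"
    using lift_Suc_antimono_le[of power_space 1 "Suc n", OF power_space_Suc_subset] by simp
  then have "{bracket a b | a b. a \<in> derived_series (power_space 1) n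
      \<and> b \<in> derived_series (power_space 1) n} \<subseteq> power_space (Suc (Suc n))"
    using Suc bracket_power_space_Suc by blast
  then show ?case
    unfolding derived_series.simps bracket_space_def
    by (rule span_minimal[OF _ subspace_power_space])
qed simp

lemma semisimple_imp_trivial:
  assumes fin: "finite_dimensional_vector_space scale Basis" and semisimple
  shows "trivial_product (\<bullet>)"
proof -
  \<comment> \<open>The centre is an abelian ideal, so semisimplicity makes it zero and excludes
    nonzero idempotents.\<close>
  define Z where "Z = {z. \<forall>u. bracket u z = 0}"
  have "lie_ideal Z"
    unfolding lie_ideal_def subspace_def Z_def by (simp add: bracket_bilinear)
  moreover have "derived_series Z 1 = {0}"
  proof -
    have "bracket_space Z Z \<subseteq> {0}"
      unfolding bracket_space_def by (rule span_minimal) (auto simp: Z_def)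
    then show ?thesis using bracket_space_0[of Z Z] by auto
  qed
  ultimately have "Z = {0}"
    using \<open>semisimple\<close> unfolding semisimple_def solvable_def by blast
  then have "e = 0" if "e \<bullet> e = e" for e
    using bracket_idempotent[OF that] by (auto simp: Z_def)
  then obtain n where n: "power_space n \<subseteq> {0}"
    using power_space_zero[OF fin] by blast
  have "derived_series (power_space 1) n \<subseteq> {0}"
    using derived_series_subset_power_space power_space_Suc_subset n by blast
  \<comment> \<open>\<open>solvable\<close> demands equality with \<open>{0}\<close>, so
    nonemptiness is checked too.\<close>
  moreover have "0 \<in> derived_series (power_space 1) n"
    using subspace_0[OF subspace_power_space, of 1] bracket_space_0
    by (cases n) (simp_all del: power_space.simps)
  ultimately have "solvable (power_space 1)"
    unfolding solvable_def by blast
  moreover have "lie_ideal (power_space 1)"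
    unfolding lie_ideal_def using subspace_power_space bracket_power_space by blast
  ultimately have "power_space 1 = {0}"
    using \<open>semisimple\<close> unfolding semisimple_def by blast
  then show ?thesis
    using prod_in_power_space[of _ 0] unfolding trivial_product_def by auto
qed

end

lemma (in lie_algebra) semisimple_poisson_structure_trivial:
  assumes fin: "finite_dimensional_vector_space scale Basis" and semisimple
    and "poisson_structure p"
  shows "trivial_product p"
proof -
  interpret poisson_algebra scale bracket p
    using \<open>poisson_structure p\<close> unfolding poisson_structure_def
    by unfold_locales blast+
  show ?thesis using semisimple_imp_trivial fin \<open>semisimple\<close> .
qed

theorem theorem3p3:
  fixes scale :: "'k::field_char_0 \<Rightarrow> 'g::ab_group_add \<Rightarrow> 'g"
    and bracket :: "'g \<Rightarrow> 'g \<Rightarrow> 'g"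
  assumes "lie_algebra scale bracket"
    and "\<exists>Basis. finite_dimensional_vector_space scale Basis"
  shows "(lie_algebra.perfect scale bracket \<longrightarrow>
           (\<forall>\<alpha>. lie_algebra.strongly_quasi_canonical scale bracket \<alpha> \<longleftrightarrow>
                \<alpha> = (\<lambda>u v. scale (1 / 2) (bracket u v)))) \<and>
         (lie_algebra.semisimple scale bracket \<longrightarrow>
           (\<forall>\<alpha>. lie_algebra.quasi_canonical scale bracket \<alpha> \<longleftrightarrow>
                \<alpha> = (\<lambda>u v. scale (1 / 2) (bracket u v))) \<and>
           (\<nexists>p. lie_algebra.poisson_structure scale bracket p \<and>
                \<not> trivial_product p))"
proof -
  interpret lie_algebra scale bracket by fact
  obtain Basis where fin: "finite_dimensional_vector_space scale Basis"
    using assms(2) by blast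
  have two: "(2::'k) \<noteq> 0" by simp
  note half = half_bracket_strongly_quasi_canonical[OF two]
  \<comment> \<open>The difference of \<open>\<alpha>\<close> and the half bracket is a Poisson
    structure, hence trivial.\<close>
  have "\<alpha> = (\<lambda>u v. scale (1 / 2) (bracket u v))" if semisimple "quasi_canonical \<alpha>" for \<alpha>
    using semisimple_poisson_structure_trivial[OF fin \<open>semisimple\<close>
        poisson_of_quasi_canonical[OF two \<open>quasi_canonical \<alpha>\<close>]]
    by (simp add: trivial_product_def fun_eq_iff)
  then show ?thesis
    using half perfect_strongly_quasi_canonical_unique[OF two]
      semisimple_poisson_structure_trivial[OF fin]
    unfolding strongly_quasi_canonical_def by blast
qed

end
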